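(* Let $N\ge 1$, $r>0$, $v>0$, and consider the scattering problem $(\mathrm{SP}_\delta)$ described in the context, with $\delta\in\mathbb{C}\setminus\{0\}$. Its resonant frequencies $\omega$ have the following properties. (1) If $\delta\in\mathbb{R}$, the set of resonant frequencies is symmetric with respect to the imaginary axis (i.e. $\omega$ is a resonant frequency if and only if $-\overline{\omega}$ is). (2) If $\delta>0$, all non-trivial resonant frequencies ($\omega\neq 0$) have negative imaginary part. (3) Let $0\neq\delta_0\in\mathbb{C}$. Then $(\mathrm{SP}_{\delta})$ with $\delta=\delta_0$ and with $\delta=r^2/\delta_0$ have the same resonant frequencies $\omega=kv$. Moreover, let $u$ and $w$ be resonant modes associated with a resonant frequency $\omega$ for $\delta=\delta_0$ and $\delta=r^2/\delta_0$, respectively, satisfying $u(x)=e^{-i\frac{\omega}{v}x}$ and $w(x)=t\,e^{-i\frac{\omega}{v}x}$ for $x<x_1^-$, for some $0\ne t\in\mathbb{C}$. Then $$u'(x)=-i\,\frac{\delta_0}{t r}\,k_b\,w(x),\qquad w'(x)=-i\,\frac{t r}{\delta_0}\,k_b\,u(x),\qquad x\in D,$$ $$u'(x)=-i\,t^{-1}k\,w(x),\qquad w'(x)=-i\,t\,k\,u(x),\qquad x\in\mathbb{R}\setminus D,$$ where at each endpoint $x_j^\pm$ the derivatives are interpreted as the one-sided derivatives taken from the side corresponding to the relation used (from inside $D$ for the first line, from outside $D$ for the second).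
   Context: Setting. $x_1^-<x_1^+<x_2^-<x_2^+<\dots<x_N^-<x_N^+$ are real numbers, $D=\bigcup_{j=1}^N(x_j^-,x_j^+)$, $\ell_j=x_j^+-x_j^-$, $s_j=x_{j+1}^--x_j^+$. The constants $v,v_b>0$ (wave speeds outside and inside $D$) are fixed and $r=v/v_b>0$. For $\omega\in\mathbb{C}$ put $k=\omega/v$ and $k_b=\omega/v_b=rk$. For a function $w$ on $\mathbb{R}$, $w|_\pm(x)=\lim_{s\to0^+}w(x\pm s)$. The scattering problem $(\mathrm{SP}_\delta)$ at frequency $\omega$ is: $u''+k^2u=0$ on $\mathbb{R}\setminus \overline{D}$; $u''+k_b^2u=0$ on $D$; for all $1\le j\le N$: $u|_+(x_j^\pm)=u|_-(x_j^\pm)$, $u'|_+(x_j^-)=\delta\,u'|_-(x_j^-)$, $u'|_-(x_j^+)=\delta\,u'|_+(x_j^+)$; and the radiation condition $-u'-iku=0$ on $(-\infty,x_1^-)$, $u'-iku=0$ on $(x_N^+,\infty)$. $\omega\in\mathbb{C}$ is a resonant frequency (resonance) if $(\mathrm{SP}_\delta)$ has a non-trivial solution $u$; such $u$ is called a resonant mode. $\omega=0$ is always a (trivial) resonant frequency. *)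

theory Defs
  imports "HOL-Analysis.Analysis"
begin

text \<open>
  The endpoints of the \<open>N\<close> resonators are given by two sequences, indexed from \<open>1\<close>:
  \<open>xm j\<close> stands for $x_j^-$ and \<open>xp j\<close> for $x_j^+$. Values at indices outside \<open>{1..N}\<close> are
  irrelevant.
\<close>

definition ordered_endpoints :: "nat \<Rightarrow> (nat \<Rightarrow> real) \<Rightarrow> (nat \<Rightarrow> real) \<Rightarrow> bool" where
  "ordered_endpoints N xm xp \<longleftrightarrow>
     (\<forall>j\<in>{1..N}. xm j < xp j) \<and> (\<forall>j\<in>{1..<N}. xp j < xm (j + 1))"

definition resonators :: "nat \<Rightarrow> (nat \<Rightarrow> real) \<Rightarrow> (nat \<Rightarrow> real) \<Rightarrow> real set" where
  "resonators N xm xp = (\<Union>j\<in>{1..N}. {xm j<..<xp j})"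

definition vderiv :: "(real \<Rightarrow> complex) \<Rightarrow> real \<Rightarrow> complex" where
  "vderiv u x = vector_derivative u (at x)"

definition helmholtz_on :: "real set \<Rightarrow> complex \<Rightarrow> (real \<Rightarrow> complex) \<Rightarrow> bool" where
  "helmholtz_on S \<kappa> u \<longleftrightarrow>
     (\<forall>x\<in>S. u differentiable (at x) \<and> vderiv u differentiable (at x) \<and>
            vderiv (vderiv u) x + \<kappa>\<^sup>2 * u x = 0)"

text \<open>
  The condition \<open>u|\<^sub>+ = u|\<^sub>-\<close> at an endpoint is read as continuity of \<open>u\<close> there, that is, the
  common one-sided limit is also the value of \<open>u\<close>. Otherwise a function supported on the
  endpoints would count as a non-trivial solution.
\<close>

definition continuous_transmission :: "(real \<Rightarrow> complex) \<Rightarrow> real \<Rightarrow> bool" where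
  "continuous_transmission u a \<longleftrightarrow>
     (u \<longlongrightarrow> u a) (at_right a) \<and> (u \<longlongrightarrow> u a) (at_left a)"

text \<open>
  In the two flux conditions, the one-sided limits of \<open>u'\<close> are required to exist. The factor
  \<open>\<delta>\<close> always multiplies the limit taken from outside the resonators: from the left at \<open>x\<^sub>j\<^sup>-\<close>, from
  the right at \<open>x\<^sub>j\<^sup>+\<close>.
\<close>

definition flux_transmission_left :: "complex \<Rightarrow> (real \<Rightarrow> complex) \<Rightarrow> real \<Rightarrow> bool" where
  "flux_transmission_left \<delta> u a \<longleftrightarrow>
     (\<exists>p m. (vderiv u \<longlongrightarrow> p) (at_right a) \<and> (vderiv u \<longlongrightarrow> m) (at_left a) \<and> p = \<delta> * m)"

definition flux_transmission_right :: "complex \<Rightarrow> (real \<Rightarrow> complex) \<Rightarrow> real \<Rightarrow> bool" where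
  "flux_transmission_right \<delta> u a \<longleftrightarrow>
     (\<exists>p m. (vderiv u \<longlongrightarrow> p) (at_right a) \<and> (vderiv u \<longlongrightarrow> m) (at_left a) \<and> m = \<delta> * p)"

definition scattering_solution ::
  "nat \<Rightarrow> (nat \<Rightarrow> real) \<Rightarrow> (nat \<Rightarrow> real) \<Rightarrow> real \<Rightarrow> real \<Rightarrow> complex \<Rightarrow> complex \<Rightarrow>
    (real \<Rightarrow> complex) \<Rightarrow> bool" where
  "scattering_solution N xm xp v v\<^sub>b \<delta> \<omega> u \<longleftrightarrow>
    (let D = resonators N xm xp; k = \<omega> / of_real v; k\<^sub>b = \<omega> / of_real v\<^sub>b in
       helmholtz_on (- closure D) k u \<and>
       helmholtz_on D k\<^sub>b u \<and>
       (\<forall>j\<in>{1..N}.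
          continuous_transmission u (xm j) \<and> continuous_transmission u (xp j) \<and>
          flux_transmission_left \<delta> u (xm j) \<and> flux_transmission_right \<delta> u (xp j)) \<and>
       (\<forall>x<xm 1. - vderiv u x - \<i> * k * u x = 0) \<and>
       (\<forall>x>xp N. vderiv u x - \<i> * k * u x = 0))"

definition resonant_mode ::
  "nat \<Rightarrow> (nat \<Rightarrow> real) \<Rightarrow> (nat \<Rightarrow> real) \<Rightarrow> real \<Rightarrow> real \<Rightarrow> complex \<Rightarrow> complex \<Rightarrow>
    (real \<Rightarrow> complex) \<Rightarrow> bool" where
  "resonant_mode N xm xp v v\<^sub>b \<delta> \<omega> u \<longleftrightarrow>
     scattering_solution N xm xp v v\<^sub>b \<delta> \<omega> u \<and> (\<exists>x. u x \<noteq> 0)"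

definition resonant_frequencies ::
  "nat \<Rightarrow> (nat \<Rightarrow> real) \<Rightarrow> (nat \<Rightarrow> real) \<Rightarrow> real \<Rightarrow> real \<Rightarrow> complex \<Rightarrow> complex set" where
  "resonant_frequencies N xm xp v v\<^sub>b \<delta> = {\<omega>. \<exists>u. resonant_mode N xm xp v v\<^sub>b \<delta> \<omega> u}"

end

theory Submission
  imports Defs
begin

text \<open>
  Everything rests on writing the scattering problem as a first-order system. Given a solution
  \<open>u\<close>, let \<open>q\<close> be \<open>u'\<close> outside the resonators and \<open>u' / \<delta>\<close> inside. The transmission conditions say
  exactly that \<open>u\<close> and \<open>q\<close> are continuous on the whole line, and the equations become
  \<open>u' = c q\<close>, \<open>q' = - (\<kappa>\<^sup>2 / c) u\<close> off the finitely many endpoints, where \<open>(c, \<kappa>)\<close> is \<open>(1, k)\<close> outside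
  and \<open>(\<delta>, r k)\<close> inside (\<open>scattering_solution_iff_flux_solution\<close>). The interfaces are thereby
  absorbed: a continuous function whose derivative has a sign off a finite set is monotone, so
  differential inequalities can be used across the endpoints.

  Uniqueness (\<open>flux_equations_eq_zero\<close>) is a Gronwall estimate for \<open>|u|\<^sup>2 + |q|\<^sup>2\<close>: a solution that
  vanishes to the left of all resonators vanishes everywhere.

  (1) For real \<open>\<delta>\<close>, complex conjugation maps solutions at \<open>k\<close> to solutions at \<open>- cnj k\<close>.

  (2) For \<open>\<delta> > 0\<close> and \<open>k \<noteq> 0\<close>, consider \<open>G = Re (\<i> (cnj k) (cnj u) q)\<close>. Its derivative is \<open>Im k\<close>
  times a nonnegative quantity, whereas the radiation conditions make \<open>G\<close> equal to \<open>|k u|\<^sup>2\<close> on the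
  left of the resonators and to \<open>- |k u|\<^sup>2\<close> on the right. If \<open>Im k \<ge> 0\<close>, then \<open>G\<close> is nondecreasing,
  which forces \<open>u = 0\<close> on the left and hence everywhere (\<open>flux_solution_eq_zero_left\<close>).

  (3) Replacing \<open>\<delta>\<close> by \<open>r\<^sup>2 / \<delta>\<close> interchanges the coefficients \<open>c\<close> and \<open>\<kappa>\<^sup>2 / c\<close> up to the constant
  factor \<open>k\<^sup>2\<close>. So \<open>(u, q) \<mapsto> (\<i> q, - \<i> k\<^sup>2 u)\<close> maps solutions for \<open>\<delta>\<close> to solutions for \<open>r\<^sup>2 / \<delta>\<close>
  (\<open>flux_solution_dual\<close>). By uniqueness the mode \<open>w\<close> is determined by its values on the left, which
  gives \<open>k w = \<i> t q\<close> (\<open>flux_solution_dual_unique\<close>), and the equation \<open>u' = c q\<close>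
  turns into the asserted formulas. The relation for \<open>w'\<close> is the same statement with the two
  modes interchanged.
\<close>

section \<open>Functions on the line with a derivative off finitely many points\<close>

text \<open>
  One-sided derivatives at the ends of an interval: the interior formula for \<open>f'\<close> extends to the
  ends because \<open>f\<close> is there the integral of the continuous function \<open>g\<close>.
\<close>

lemma has_vector_derivative_Icc_of_interior:
  fixes f g :: "real \<Rightarrow> complex"
  assumes f: "continuous_on {a..b} f" and g: "continuous_on {a..b} g"
    and der: "\<And>y. y \<in> {a<..<b} \<Longrightarrow> (f has_vector_derivative g y) (at y)"
    and x: "x \<in> {a..b}"
  shows "(f has_vector_derivative g x) (at x within {a..b})"
proof -
  have eq: "f y = f a + integral {a..y} g" if y: "y \<in> {a..b}" for y
  proof -
    have "(g has_integral (f y - f a)) {a..y}"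
      by (rule fundamental_theorem_of_calculus_interior)
        (use y der continuous_on_subset[OF f, of "{a..y}"] in auto)
    then show ?thesis
      by (simp add: integral_unique)
  qed
  have "((\<lambda>y. f a + integral {a..y} g) has_vector_derivative 0 + g x) (at x within {a..b})"
    by (intro has_vector_derivative_add has_vector_derivative_const
        integral_has_vector_derivative g x)
  then have "((\<lambda>y. f a + integral {a..y} g) has_vector_derivative g x) (at x within {a..b})"
    by simp
  then show ?thesis
    by (rule has_vector_derivative_transform[OF x, rotated]) (rule eq)
qed

lemma has_vector_derivative_within_Un:
  assumes "(f has_vector_derivative l) (at x within S)" "(f has_vector_derivative l) (at x within T)"
  shows "(f has_vector_derivative l) (at x within S \<union> T)"
  using assms unfolding has_vector_derivative_def has_derivative_within
  by (auto intro: Lim_Un)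

text \<open>
  Passes from single intervals to their finite union. Closedness lets the sets that miss \<open>x\<close> be
  ignored, since they stay away from a neighbourhood of \<open>x\<close>.
\<close>

lemma has_vector_derivative_within_UN_closed:
  fixes f :: "real \<Rightarrow> complex"
  assumes "finite I" and "\<And>i. i \<in> I \<Longrightarrow> closed (S i)"
    and "\<And>i. i \<in> I \<Longrightarrow> x \<in> S i \<Longrightarrow> (f has_vector_derivative l) (at x within S i)"
  shows "(f has_vector_derivative l) (at x within (\<Union>i\<in>I. S i))"
  using assms
proof (induction I rule: finite_induct)
  case empty
  then show ?case
    by (simp add: has_vector_derivative_def has_derivative_def bounded_linear_scaleR_left)
next
  case (insert i I)
  have "(f has_vector_derivative l) (at x within S i)"
  proof (cases "x \<in> S i")
    case False
    then have "at x within S i = bot"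
      using not_in_closure_trivial_limitI[of x "S i"] insert.prems(1)[of i] by simp
    then show ?thesis
      by (simp add: has_vector_derivative_def has_derivative_def bounded_linear_scaleR_left)
  qed (use insert.prems in auto)
  moreover have "(f has_vector_derivative l) (at x within (\<Union>i\<in>I. S i))"
    using insert by auto
  ultimately show ?case
    using has_vector_derivative_within_Un by auto
qed

text \<open>
  The exceptional set \<open>F\<close> will be the set of endpoints of the resonators, where the fields are
  continuous but have a kink. Integrating the derivative, set to \<open>0\<close> on \<open>F\<close>, gives the claim.
\<close>

lemma mono_of_derivative_nonneg_off_finite:
  fixes h :: "real \<Rightarrow> real"
  assumes "a \<le> b" and "finite F" and "continuous_on {a..b} h"
    and der: "\<And>x. x \<notin> F \<Longrightarrow> \<exists>l\<ge>0. (h has_vector_derivative l) (at x)"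
  shows "h a \<le> h b"
proof -
  obtain h' where h': "\<And>x. x \<notin> F \<Longrightarrow> h' x \<ge> 0 \<and> (h has_vector_derivative h' x) (at x)"
    using der by metis
  define g where "g x = (if x \<in> F then 0 else h' x)" for x
  have "(g has_integral (h b - h a)) {a..b}"
    by (rule fundamental_theorem_of_calculus_interior_strong[OF \<open>finite F\<close> \<open>a \<le> b\<close>])
      (use h' assms(3) in \<open>auto simp: g_def\<close>)
  then have "0 \<le> h b - h a"
    by (rule has_integral_nonneg) (use h' in \<open>auto simp: g_def\<close>)
  then show ?thesis
    by simp
qed


section \<open>The geometry of the resonators\<close>

locale resonator_chain =
  fixes N :: nat and xm xp :: "nat \<Rightarrow> real"
  assumes N: "N \<ge> 1" and ordered: "ordered_endpoints N xm xp"
begin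

abbreviation D :: "real set" where
  "D \<equiv> resonators N xm xp"

definition endpoints :: "real set" where
  "endpoints = xm ` {1..N} \<union> xp ` {1..N}"

text \<open>
  \<open>gap_start j\<close> and \<open>gap_end j\<close> bound an interval free of resonators just before and just after the
  \<open>j\<close>-th one. The two unbounded components of the exterior are cut off at distance \<open>1\<close>, so that
  the outermost resonators need no separate treatment in one-sided limits.
\<close>

definition gap_start :: "nat \<Rightarrow> real" where
  "gap_start j = (if j = 1 then xm 1 - 1 else xp (j - 1))"

definition gap_end :: "nat \<Rightarrow> real" where
  "gap_end j = (if j = N then xp N + 1 else xm (j + 1))"

lemma finite_endpoints: "finite endpoints"
  by (simp add: endpoints_def)

lemma xm_less_xp: "j \<in> {1..N} \<Longrightarrow> xm j < xp j"
  using ordered by (auto simp: ordered_endpoints_def)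

lemma xp_less_xm_Suc: "1 \<le> j \<Longrightarrow> j < N \<Longrightarrow> xp j < xm (Suc j)"
  using ordered by (auto simp: ordered_endpoints_def)

lemma xp_less_xm:
  assumes "1 \<le> i" "i < j" "j \<le> N"
  shows "xp i < xm j"
  using assms(2,3)
proof (induction j rule: less_induct)
  case (less j)
  show ?case
  proof (cases "j = Suc i")
    case True
    then show ?thesis
      using xp_less_xm_Suc[of i] less.prems assms(1) by auto
  next
    case False
    then have "xp i < xm (j - 1)"
      using less by auto
    also have "\<dots> < xp (j - 1)"
      using less.prems assms(1) by (intro xm_less_xp) auto
    also have "\<dots> < xm j"
      using xp_less_xm_Suc[of "j - 1"] less.prems assms(1) by auto
    finally show ?thesis .
  qed
qed

lemma xm_1_le: "j \<in> {1..N} \<Longrightarrow> xm 1 \<le> xm j"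
  using xp_less_xm[of 1 j] xm_less_xp[of 1] N by (cases "j = 1") auto

lemma le_xp_N: "j \<in> {1..N} \<Longrightarrow> xp j \<le> xp N"
  using xp_less_xm[of j N] xm_less_xp[of N] N by (cases "j = N") auto

lemma open_D: "open D"
  by (auto simp: resonators_def)

lemma closure_D: "closure D = (\<Union>j\<in>{1..N}. {xm j..xp j})"
proof -
  have "closure (\<Union>j\<in>I. {xm j<..<xp j}) = (\<Union>j\<in>I. {xm j..xp j})"
    if "finite I" "I \<subseteq> {1..N}" for I
    using that
  proof (induction I rule: finite_induct)
    case (insert i I)
    then show ?case
      using xm_less_xp[of i] by simp
  qed simp
  then show ?thesis
    by (simp add: resonators_def)
qed

lemma open_exterior: "open (- closure D)"
  by auto

lemma Ioo_subset_D: "j \<in> {1..N} \<Longrightarrow> {xm j<..<xp j} \<subseteq> D"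
  by (auto simp: resonators_def)

lemma below_subset_exterior: "{..<xm 1} \<subseteq> - closure D"
  using xm_1_le by (force simp: closure_D)

lemma above_subset_exterior: "{xp N<..} \<subseteq> - closure D"
  using le_xp_N by (force simp: closure_D)

lemma between_subset_exterior:
  assumes "1 \<le> j" "j < N"
  shows "{xp j<..<xm (Suc j)} \<subseteq> - closure D"
proof -
  have False if x: "xp j < x" "x < xm (Suc j)" and i: "i \<in> {1..N}" "xm i \<le> x" "x \<le> xp i" for x i
  proof (cases "i \<le> j")
    case True
    then have "xp i \<le> xp j"
      using xp_less_xm[of i j] xm_less_xp[of j] assms i by (cases "i = j") auto
    then show False
      using x i by simp
  next
    case False
    then have "xm (Suc j) \<le> xm i"
      using xp_less_xm[of "Suc j" i] xm_less_xp[of "Suc j"] assms i by (cases "i = Suc j") auto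
    then show False
      using x i by simp
  qed
  then show ?thesis
    by (fastforce simp: closure_D)
qed

lemma gap_before:
  assumes "j \<in> {1..N}"
  shows "gap_start j < xm j" "{gap_start j<..<xm j} \<subseteq> - closure D"
proof -
  show "gap_start j < xm j"
    using xp_less_xm_Suc[of "j - 1"] assms by (auto simp: gap_start_def)
  show "{gap_start j<..<xm j} \<subseteq> - closure D"
  proof (cases "j = 1")
    case True
    then show ?thesis
      using below_subset_exterior by auto
  next
    case False
    then show ?thesis
      using between_subset_exterior[of "j - 1"] assms by (fastforce simp: gap_start_def)
  qed
qed

lemma gap_after:
  assumes "j \<in> {1..N}"
  shows "xp j < gap_end j" "{xp j<..<gap_end j} \<subseteq> - closure D"
proof -
  show "xp j < gap_end j"
    using xp_less_xm_Suc[of j] assms by (auto simp: gap_end_def)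
  show "{xp j<..<gap_end j} \<subseteq> - closure D"
    using above_subset_exterior between_subset_exterior[of j] assms
    by (auto simp: gap_end_def split: if_splits)
qed

lemma outside_D_cases:
  assumes "x \<notin> D"
  obtains "x \<le> xm 1" | "xp N \<le> x" | j where "1 \<le> j" "j < N" "xp j \<le> x" "x \<le> xm (Suc j)"
proof (cases "x \<le> xm 1 \<or> xp N \<le> x")
  case False
  \<comment> \<open>The gap containing \<open>x\<close> starts at the last resonator whose left endpoint is below \<open>x\<close>.\<close>
  define J where "J = {i \<in> {1..N}. xm i < x}"
  have J: "finite J" "J \<noteq> {}"
    using False N by (auto simp: J_def)
  define j where "j = Max J"
  have j: "j \<in> {1..N}" "xm j < x"
    using Max_in[OF J] by (auto simp: j_def J_def)
  then have "xp j \<le> x"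
    using assms Ioo_subset_D[of j] by force
  moreover have "j < N"
    using j False \<open>xp j \<le> x\<close> by (cases "j = N") auto
  moreover have "Suc j \<notin> J"
    using Max_ge[OF J(1), of "Suc j"] by (auto simp: j_def)
  then have "x \<le> xm (Suc j)"
    using \<open>j < N\<close> by (auto simp: J_def)
  ultimately show thesis
    using j that by auto
qed (use that in auto)

lemma not_endpoint_cases: "x \<notin> endpoints \<Longrightarrow> x \<in> D \<or> x \<in> - closure D"
proof -
  assume x: "x \<notin> endpoints"
  have "x \<in> D" if x': "x \<in> closure D"
  proof -
    obtain j where j: "j \<in> {1..N}" "xm j \<le> x" "x \<le> xp j"
      using x' unfolding closure_D by auto
    then have "x \<noteq> xm j" "x \<noteq> xp j"
      using x by (auto simp: endpoints_def)
    then show ?thesis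
      using j Ioo_subset_D[of j] by auto
  qed
  then show ?thesis
    by blast
qed

lemma endpoint_not_interior:
  assumes "x \<in> endpoints"
  shows "x \<in> closure D" "x \<notin> D"
proof -
  show "x \<in> closure D"
    using assms xm_less_xp by (force simp: endpoints_def closure_D)
  have "xm j \<notin> D \<and> xp j \<notin> D" if j: "j \<in> {1..N}" for j
  proof -
    have "\<not> (xm i < xm j \<and> xm j < xp i) \<and> \<not> (xm i < xp j \<and> xp j < xp i)"
      if i: "i \<in> {1..N}" for i
      using i j xp_less_xm[of i j] xp_less_xm[of j i] xm_less_xp[of i] xm_less_xp[of j]
      by (cases i j rule: linorder_cases) auto
    then show ?thesis
      by (auto simp: resonators_def)
  qed
  then show "x \<notin> D"
    using assms by (auto simp: endpoints_def)
qed

lemma eventually_sides: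
  assumes "j \<in> {1..N}"
  shows "\<forall>\<^sub>F y in at_right (xm j). y \<in> D" "\<forall>\<^sub>F y in at_left (xp j). y \<in> D"
    "\<forall>\<^sub>F y in at_left (xm j). y \<in> - closure D" "\<forall>\<^sub>F y in at_right (xp j). y \<in> - closure D"
  using eventually_at_right_real[OF xm_less_xp[OF assms]]
    eventually_at_left_real[OF xm_less_xp[OF assms]]
    eventually_at_left_real[OF gap_before(1)[OF assms]]
    eventually_at_right_real[OF gap_after(1)[OF assms]]
    Ioo_subset_D[OF assms] gap_before(2)[OF assms] gap_after(2)[OF assms]
  by (auto elim!: eventually_mono)

text \<open>
  The next two lemmas extend derivatives to the one-sided ones at the endpoints, from inside and
  from outside. They are what converts the system into the form of the derivatives in
  the theorem.
\<close>

lemma has_vector_derivative_within_closure_D: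
  fixes f g :: "real \<Rightarrow> complex"
  assumes "continuous_on UNIV f" "continuous_on UNIV g"
    and "\<And>y. y \<in> D \<Longrightarrow> (f has_vector_derivative g y) (at y)"
  shows "(f has_vector_derivative g x) (at x within closure D)"
  unfolding closure_D
proof (rule has_vector_derivative_within_UN_closed)
  fix j assume "j \<in> {1..N}" "x \<in> {xm j..xp j}"
  then show "(f has_vector_derivative g x) (at x within {xm j..xp j})"
    using assms Ioo_subset_D[of j]
    by (intro has_vector_derivative_Icc_of_interior)
      (auto intro: continuous_on_subset)
qed auto

lemma has_vector_derivative_within_outside_D:
  fixes f g :: "real \<Rightarrow> complex"
  assumes fg: "continuous_on UNIV f" "continuous_on UNIV g"
    and der: "\<And>y. y \<in> - closure D \<Longrightarrow> (f has_vector_derivative g y) (at y)"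
  shows "(f has_vector_derivative g x) (at x within - D)"
proof -
  have Icc: "(f has_vector_derivative g x) (at x within {a..b})"
    if "x \<in> {a..b}" "{a<..<b} \<subseteq> - closure D" for a b
    using that fg der
    by (intro has_vector_derivative_Icc_of_interior) (auto intro: continuous_on_subset)
  \<comment> \<open>The two unbounded components are cut off near \<open>x\<close>, so that only compact intervals occur.\<close>
  define T where "T = ({x - 1..xm 1} \<union> {xp N..x + 1}) \<union> (\<Union>j\<in>{1..<N}. {xp j..xm (Suc j)})"
  have "(f has_vector_derivative g x) (at x within (\<Union>j\<in>{1..<N}. {xp j..xm (Suc j)}))"
    by (rule has_vector_derivative_within_UN_closed)
      (use Icc between_subset_exterior in auto)
  moreover have below: "{x - 1<..<xm 1} \<subseteq> - closure D" and above: "{xp N<..<x + 1} \<subseteq> - closure D"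
    using below_subset_exterior above_subset_exterior by auto
  have "(f has_vector_derivative g x) (at x within (\<Union>i\<in>{0::nat,1}.
      if i = 0 then {x - 1..xm 1} else {xp N..x + 1}))"
    by (rule has_vector_derivative_within_UN_closed)
      (use Icc[OF _ below] Icc[OF _ above] in \<open>auto split: if_splits\<close>)
  then have "(f has_vector_derivative g x) (at x within {x - 1..xm 1} \<union> {xp N..x + 1})"
    by (simp add: Un_commute)
  ultimately have "(f has_vector_derivative g x) (at x within T)"
    unfolding T_def by (blast intro: has_vector_derivative_within_Un)
  moreover have "- D \<inter> {x - 1<..<x + 1} \<subseteq> T"
  proof
    fix y assume y: "y \<in> - D \<inter> {x - 1<..<x + 1}"
    then have "y \<notin> D" by simp
    then show "y \<in> T"
      by (cases rule: outside_D_cases) (use y in \<open>auto simp: T_def\<close>)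
  qed
  ultimately have "(f has_vector_derivative g x) (at x within - D \<inter> {x - 1<..<x + 1})"
    by (rule has_vector_derivative_within_subset)
  moreover have "at x within - D = at x within - D \<inter> {x - 1<..<x + 1}"
    by (rule at_within_nhd[of _ "{x - 1<..<x + 1}"]) auto
  ultimately show ?thesis
    by simp
qed


section \<open>The first-order system\<close>

text \<open>
  The radiation conditions are kept apart because uniqueness concerns the equations alone: it is
  a statement about the initial value problem started on the left of the resonators.
\<close>

definition flux_equations ::
  "real \<Rightarrow> complex \<Rightarrow> complex \<Rightarrow> (real \<Rightarrow> complex) \<Rightarrow> (real \<Rightarrow> complex) \<Rightarrow> bool" where
  "flux_equations r \<delta> k u q \<longleftrightarrow>
     continuous_on UNIV u \<and> continuous_on UNIV q \<and>
     (\<forall>x\<in>D. (u has_vector_derivative \<delta> * q x) (at x) \<and>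
            (q has_vector_derivative - ((of_real r * k)\<^sup>2 / \<delta>) * u x) (at x)) \<and>
     (\<forall>x\<in>- closure D. (u has_vector_derivative q x) (at x) \<and>
            (q has_vector_derivative - k\<^sup>2 * u x) (at x))"

definition flux_solution ::
  "real \<Rightarrow> complex \<Rightarrow> complex \<Rightarrow> (real \<Rightarrow> complex) \<Rightarrow> (real \<Rightarrow> complex) \<Rightarrow> bool" where
  "flux_solution r \<delta> k u q \<longleftrightarrow>
     flux_equations r \<delta> k u q \<and>
     (\<forall>x<xm 1. q x = - \<i> * k * u x) \<and> (\<forall>x>xp N. q x = \<i> * k * u x)"

lemma flux_equationsI:
  assumes "continuous_on UNIV u" "continuous_on UNIV q"
    and "\<And>x. x \<in> D \<Longrightarrow> (u has_vector_derivative \<delta> * q x) (at x)"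
    and "\<And>x. x \<in> D \<Longrightarrow> (q has_vector_derivative - ((of_real r * k)\<^sup>2 / \<delta>) * u x) (at x)"
    and "\<And>x. x \<in> - closure D \<Longrightarrow> (u has_vector_derivative q x) (at x)"
    and "\<And>x. x \<in> - closure D \<Longrightarrow> (q has_vector_derivative - k\<^sup>2 * u x) (at x)"
  shows "flux_equations r \<delta> k u q"
  using assms by (simp add: flux_equations_def)

lemma flux_equationsD:
  assumes "flux_equations r \<delta> k u q"
  shows "continuous_on UNIV u" "continuous_on UNIV q"
    and "x \<in> D \<Longrightarrow> (u has_vector_derivative \<delta> * q x) (at x)"
    and "x \<in> D \<Longrightarrow> (q has_vector_derivative - ((of_real r * k)\<^sup>2 / \<delta>) * u x) (at x)"
    and "x \<in> - closure D \<Longrightarrow> (u has_vector_derivative q x) (at x)"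
    and "x \<in> - closure D \<Longrightarrow> (q has_vector_derivative - k\<^sup>2 * u x) (at x)"
  using assms by (auto simp: flux_equations_def)

lemma flux_equations_linear_combination:
  assumes "flux_equations r \<delta> k u q" "flux_equations r \<delta> k w p"
  shows "flux_equations r \<delta> k (\<lambda>x. a * u x + b * w x) (\<lambda>x. a * q x + b * p x)"
  using assms unfolding flux_equations_def
  by (auto intro!: continuous_intros derivative_eq_intros simp: algebra_simps add_divide_distrib)

text \<open>
  Gronwall: with \<open>E = |u|\<^sup>2 + |q|\<^sup>2\<close> and a constant \<open>C\<close> that bounds the coefficients on both sides of
  the interfaces, \<open>E' \<le> C E\<close>, so \<open>exp (- C y) E y\<close> is nonincreasing. It is nonnegative and starts
  at \<open>0\<close>.
\<close>

lemma flux_equations_eq_zero: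
  assumes eqs: "flux_equations r \<delta> k u q"
    and zero: "\<And>x. x < xm 1 \<Longrightarrow> u x = 0 \<and> q x = 0"
  shows "u x = 0 \<and> q x = 0"
proof -
  \<comment> \<open>The squared norms are written as a product of complex functions, which is what the product
    rule applies to.\<close>
  define E where "E y = Re (cnj (u y) * u y + cnj (q y) * q y)" for y
  define C where "C = 1 + cmod \<delta> + cmod ((of_real r * k)\<^sup>2 / \<delta>) + cmod (k\<^sup>2)"
  define h where "h y = - (exp (- C * y) * E y)" for y
  have E_eq: "E y = (cmod (u y))\<^sup>2 + (cmod (q y))\<^sup>2" for y
    by (simp add: E_def cmod_def power2_eq_square)
  have contu: "continuous_on UNIV u" and contq: "continuous_on UNIV q"
    using eqs by (auto simp: flux_equations_def)
  have "continuous_on UNIV h"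
    unfolding h_def E_def by (intro continuous_intros contu contq)
  then have conth: "continuous_on {a..b} h" for a b
    by (rule continuous_on_subset) simp
  have der: "\<exists>l\<ge>0. (h has_vector_derivative l) (at y)" if y: "y \<notin> endpoints" for y
  proof -
    have "\<exists>c d. (u has_vector_derivative c * q y) (at y) \<and> (q has_vector_derivative d * u y) (at y)
            \<and> cmod c + cmod d \<le> C"
    proof (cases "y \<in> D")
      case True
      then show ?thesis
        using eqs unfolding flux_equations_def
        by (intro exI[of _ \<delta>] exI[of _ "- ((of_real r * k)\<^sup>2 / \<delta>)"]) (auto simp: C_def)
    next
      case False
      then have "y \<in> - closure D"
        using not_endpoint_cases[OF y] by simp
      then show ?thesis
        using eqs unfolding flux_equations_def
        by (intro exI[of _ 1] exI[of _ "- k\<^sup>2"]) (auto simp: C_def)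
    qed
    then obtain c d where u': "(u has_vector_derivative c * q y) (at y)"
      and q': "(q has_vector_derivative d * u y) (at y)" and cd: "cmod c + cmod d \<le> C"
      by blast
    define E' where "E' = Re (cnj (u y) * (c * q y) + cnj (c * q y) * u y +
        (cnj (q y) * (d * u y) + cnj (d * u y) * q y))"
    have "((\<lambda>y. cnj (u y) * u y + cnj (q y) * q y) has_vector_derivative
        cnj (u y) * (c * q y) + cnj (c * q y) * u y +
        (cnj (q y) * (d * u y) + cnj (d * u y) * q y)) (at y)"
      by (intro has_vector_derivative_add has_vector_derivative_mult has_vector_derivative_cnj u' q')
    then have dE: "(E has_vector_derivative E') (at y)"
      unfolding E_def E'_def by (rule bounded_linear.has_vector_derivative[OF bounded_linear_Re])
    have "(h has_vector_derivative exp (- C * y) * (C * E y - E')) (at y)"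
      using dE unfolding h_def has_real_derivative_iff_has_vector_derivative[symmetric]
      by (auto intro!: derivative_eq_intros simp: algebra_simps)
    moreover have "E' \<le> C * E y"
    proof -
      have "E' \<le> cmod (cnj (u y) * (c * q y)) + cmod (cnj (c * q y) * u y) +
          (cmod (cnj (q y) * (d * u y)) + cmod (cnj (d * u y) * q y))"
        unfolding E'_def
        by (intro order_trans[OF complex_Re_le_cmod] norm_triangle_mono norm_triangle_ineq order_refl)
      also have "\<dots> = (cmod c + cmod d) * (2 * cmod (u y) * cmod (q y))"
        by (simp add: norm_mult algebra_simps)
      also have "\<dots> \<le> C * E y"
        using sum_squares_bound[of "cmod (u y)" "cmod (q y)"] cd
        by (intro mult_mono) (auto simp: E_eq C_def)
      finally show ?thesis .
    qed
    ultimately show ?thesis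
      by (intro exI[of _ "exp (- C * y) * (C * E y - E')"]) auto
  qed
  \<comment> \<open>A starting point to the left of both \<open>x\<close> and the resonators.\<close>
  define a where "a = min x (xm 1 - 1)"
  have "h a \<le> h x"
    by (rule mono_of_derivative_nonneg_off_finite[OF _ finite_endpoints conth der])
      (auto simp: a_def)
  moreover have "h a = 0"
    using zero[of a] by (simp add: h_def E_def a_def)
  ultimately have "E x \<le> 0"
    by (simp add: h_def mult_le_0_iff)
  then show ?thesis
    by (simp add: E_eq sum_power2_le_zero_iff)
qed

text \<open>
  The radiation conditions change the sign of \<open>\<i>\<close> under conjugation; passing from \<open>k\<close> to
  \<open>- cnj k\<close> rather than \<open>cnj k\<close> compensates this, and the equations see only \<open>k\<^sup>2\<close>.
\<close>

lemma flux_solution_conjugate: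
  assumes "flux_solution r \<delta> k u q" and "\<delta> \<in> \<real>"
  shows "flux_solution r \<delta> (- cnj k) (\<lambda>x. cnj (u x)) (\<lambda>x. cnj (q x))"
proof -
  have d: "cnj \<delta> = \<delta>"
    using assms(2) by (simp add: Reals_cnj_iff)
  have *: "((\<lambda>x. cnj (f x)) has_vector_derivative l) (at x)"
    if "(f has_vector_derivative l') (at x)" "l = cnj l'" for f l l' x
    using has_vector_derivative_cnj[OF that(1)] that(2) by simp
  have eqs: "flux_equations r \<delta> k u q"
    using assms(1) by (simp add: flux_solution_def)
  have "flux_equations r \<delta> (- cnj k) (\<lambda>x. cnj (u x)) (\<lambda>x. cnj (q x))"
  proof (rule flux_equationsI)
    show "continuous_on UNIV (\<lambda>x. cnj (u x))" "continuous_on UNIV (\<lambda>x. cnj (q x))"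
      by (intro continuous_intros flux_equationsD[OF eqs])+
  qed ((rule *, erule flux_equationsD[OF eqs], simp add: d)+)
  then show ?thesis
    using assms(1) by (auto simp: flux_solution_def)
qed

text \<open>
  Write \<open>\<kappa>\<^sup>2 = \<rho>\<^sup>2 k\<^sup>2\<close> with \<open>\<rho> = 1\<close> outside and \<open>\<rho> = r\<close> inside. The new pair satisfies
  \<open>(\<i> q)' = - \<i> (\<kappa>\<^sup>2 / c) u = (\<rho>\<^sup>2 / c) (- \<i> k\<^sup>2 u)\<close>, so its coefficient is \<open>\<rho>\<^sup>2 / c\<close>, that is, \<open>1\<close>
  outside and \<open>r\<^sup>2 / \<delta>\<close> inside. The scaling of the pair avoids dividing by \<open>k\<close>, which may be \<open>0\<close>.
\<close>

lemma flux_solution_dual: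
  assumes sol: "flux_solution r \<delta> k u q" and "\<delta> \<noteq> 0" "r \<noteq> 0"
  shows "flux_solution r (of_real (r\<^sup>2) / \<delta>) k (\<lambda>x. \<i> * q x) (\<lambda>x. - \<i> * k\<^sup>2 * u x)"
proof -
  have *: "((\<lambda>x. c * f x) has_vector_derivative l) (at x)"
    if "(f has_vector_derivative l') (at x)" "l = c * l'" for f c x and l l' :: complex
    using has_vector_derivative_mult_right[OF that(1), of c] that(2) by simp
  have eqs: "flux_equations r \<delta> k u q"
    using sol by (simp add: flux_solution_def)
  have "flux_equations r (of_real (r\<^sup>2) / \<delta>) k (\<lambda>x. \<i> * q x) (\<lambda>x. - \<i> * k\<^sup>2 * u x)"
  proof (rule flux_equationsI)
    show "continuous_on UNIV (\<lambda>x. \<i> * q x)" "continuous_on UNIV (\<lambda>x. - \<i> * k\<^sup>2 * u x)"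
      by (intro continuous_intros flux_equationsD[OF eqs])+
  qed ((rule *, erule flux_equationsD[OF eqs],
        use assms(2,3) in \<open>simp add: power2_eq_square field_simps\<close>)+)
  then show ?thesis
    using sol by (auto simp: flux_solution_def power2_eq_square algebra_simps)
qed

text \<open>
  The quantity \<open>G\<close> is nondecreasing because the factor \<open>cnj k\<close> makes both terms of the derivative of
  \<open>(cnj u) q\<close> contribute with the sign of \<open>Im k\<close>: \<open>Re (\<i> cnj k) = Im k\<close> and
  \<open>Re (- \<i> (cnj k) k\<^sup>2) = |k|\<^sup>2 Im k\<close>. The radiation conditions give it the wrong signs at the two ends.
\<close>

lemma flux_solution_eq_zero_left:
  assumes sol: "flux_solution r \<delta> k u q" and \<delta>: "\<delta> = of_real d" "d > 0"
    and k: "k \<noteq> 0" "Im k \<ge> 0" and x: "x < xm 1"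
  shows "u x = 0"
proof -
  define G where "G y = Re (\<i> * cnj k * (cnj (u y) * q y))" for y
  have eqs: "flux_equations r \<delta> k u q"
    using sol by (simp add: flux_solution_def)
  have contu: "continuous_on UNIV u" and contq: "continuous_on UNIV q"
    using eqs by (auto simp: flux_equations_def)
  have "continuous_on UNIV G"
    unfolding G_def by (intro continuous_intros contu contq)
  then have contG: "continuous_on {a..b} G" for a b
    by (rule continuous_on_subset) simp
  have der: "\<exists>l\<ge>0. (G has_vector_derivative l) (at y)" if y: "y \<notin> endpoints" for y
  proof -
    have "\<exists>c\<ge>0. \<exists>e\<ge>0. (u has_vector_derivative of_real c * q y) (at y) \<and>
        (q has_vector_derivative - (of_real e * k\<^sup>2) * u y) (at y)"
    proof (cases "y \<in> D")
      case True
      then show ?thesis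
        using eqs \<delta> unfolding flux_equations_def
        by (intro exI[of _ d] exI[of _ "r\<^sup>2 / d"] conjI) (auto simp: power_mult_distrib)
    next
      case False
      then have "y \<in> - closure D"
        using not_endpoint_cases[OF y] by simp
      then show ?thesis
        using eqs unfolding flux_equations_def
        by (intro exI[of _ 1] conjI) auto
    qed
    then obtain c e where ce: "c \<ge> 0" "e \<ge> 0"
      and u': "(u has_vector_derivative of_real c * q y) (at y)"
      and q': "(q has_vector_derivative - (of_real e * k\<^sup>2) * u y) (at y)"
      by blast
    have "((\<lambda>y. \<i> * cnj k * (cnj (u y) * q y)) has_vector_derivative
        \<i> * cnj k * (cnj (u y) * (- (of_real e * k\<^sup>2) * u y) + cnj (of_real c * q y) * q y)) (at y)"
      by (intro has_vector_derivative_mult_right has_vector_derivative_mult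
          has_vector_derivative_cnj u' q')
    then have "(G has_vector_derivative Re (\<i> * cnj k *
        (cnj (u y) * (- (of_real e * k\<^sup>2) * u y) + cnj (of_real c * q y) * q y))) (at y)"
      unfolding G_def by (rule bounded_linear.has_vector_derivative[OF bounded_linear_Re])
    moreover have "Re (\<i> * cnj k *
          (cnj (u y) * (- (of_real e * k\<^sup>2) * u y) + cnj (of_real c * q y) * q y)) =
        Im k * (c * (cmod (q y))\<^sup>2 + e * (cmod k)\<^sup>2 * (cmod (u y))\<^sup>2)"
      unfolding cmod_power2 by (simp add: power2_eq_square algebra_simps)
    moreover have "\<dots> \<ge> 0"
      using ce k by simp
    ultimately show ?thesis
      by metis
  qed
  define b where "b = xp N + 1"
  have xb: "x \<le> b"
    using x xm_1_le[of N] xm_less_xp[of N] N by (auto simp: b_def)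
  have "G x \<le> G b"
    by (rule mono_of_derivative_nonneg_off_finite[OF xb finite_endpoints contG der])
  moreover have "G x = (cmod k)\<^sup>2 * (cmod (u x))\<^sup>2"
  proof -
    have "q x = - \<i> * k * u x"
      using sol x by (simp add: flux_solution_def)
    then show ?thesis
      unfolding G_def cmod_power2 by (simp add: power2_eq_square algebra_simps)
  qed
  moreover have "G b = - ((cmod k)\<^sup>2 * (cmod (u b))\<^sup>2)"
  proof -
    have "q b = \<i> * k * u b"
      using sol by (simp add: flux_solution_def b_def)
    then show ?thesis
      unfolding G_def cmod_power2 by (simp add: power2_eq_square algebra_simps)
  qed
  ultimately have "(cmod k)\<^sup>2 * (cmod (u x))\<^sup>2 \<le> 0"
    by (smt (verit) mult_nonneg_nonneg zero_le_power2)
  then show ?thesis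
    using k by (simp add: mult_le_0_iff)
qed


section \<open>Equivalence with the scattering problem\<close>

text \<open>
  From left to right, \<open>q\<close> is the exterior-normalised derivative of \<open>u\<close>. At an endpoint its two
  one-sided limits agree by the flux condition, and \<open>q\<close> is given this common value there, whatever
  the value of the derivative of \<open>u\<close> at that point.
\<close>

lemma scattering_solution_iff_flux_solution:
  assumes \<delta>: "\<delta> \<noteq> 0" and v: "v > 0" "v\<^sub>b > 0"
  shows "scattering_solution N xm xp v v\<^sub>b \<delta> \<omega> u \<longleftrightarrow>
    (\<exists>q. flux_solution (v / v\<^sub>b) \<delta> (\<omega> / of_real v) u q)"
proof -
  define k where "k = \<omega> / of_real v"
  have kb: "\<omega> / of_real v\<^sub>b = of_real (v / v\<^sub>b) * k"
    using v by (simp add: k_def)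
  show ?thesis
  proof
    assume sol: "scattering_solution N xm xp v v\<^sub>b \<delta> \<omega> u"
    have helm_out: "helmholtz_on (- closure D) k u"
      and helm_in: "helmholtz_on D (of_real (v / v\<^sub>b) * k) u"
      and trans: "\<And>j. j \<in> {1..N} \<Longrightarrow>
          continuous_transmission u (xm j) \<and> continuous_transmission u (xp j) \<and>
          flux_transmission_left \<delta> u (xm j) \<and> flux_transmission_right \<delta> u (xp j)"
      and left: "\<And>x. x < xm 1 \<Longrightarrow> - vderiv u x - \<i> * k * u x = 0"
      and right: "\<And>x. x > xp N \<Longrightarrow> vderiv u x - \<i> * k * u x = 0"
      using sol unfolding scattering_solution_def Let_def kb[symmetric] k_def[symmetric] by auto
    define q0 where "q0 x = (if x \<in> D then vderiv u x / \<delta> else vderiv u x)" for x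
    define q where "q x = (if x \<in> endpoints then Lim (at x) q0 else q0 x)" for x
    have q_in: "q x = vderiv u x / \<delta>" if "x \<in> D" for x
      using that endpoint_not_interior by (auto simp: q_def q0_def)
    have q_out: "q x = vderiv u x" if "x \<in> - closure D" for x
      using that endpoint_not_interior closure_subset[of D] by (auto simp: q_def q0_def)
    have u': "(u has_vector_derivative vderiv u x) (at x)"
      and u'': "(vderiv u has_vector_derivative - \<kappa>\<^sup>2 * u x) (at x)"
      if "helmholtz_on S \<kappa> u" "x \<in> S" for x S \<kappa>
    proof -
      have *: "u differentiable (at x)" "vderiv u differentiable (at x)"
        "vderiv (vderiv u) x + \<kappa>\<^sup>2 * u x = 0"
        using that by (auto simp: helmholtz_on_def)
      then show "(u has_vector_derivative vderiv u x) (at x)"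
        by (simp add: vector_derivative_works vderiv_def)
      have "vderiv (vderiv u) x = - \<kappa>\<^sup>2 * u x"
        using *(3) by (simp add: eq_neg_iff_add_eq_0)
      then show "(vderiv u has_vector_derivative - \<kappa>\<^sup>2 * u x) (at x)"
        using *(2) by (metis vector_derivative_works vderiv_def)
    qed
    have u'_in: "(u has_vector_derivative \<delta> * q x) (at x)" if "x \<in> D" for x
      using u'[OF helm_in that] q_in[OF that] \<delta> by simp
    have u'_out: "(u has_vector_derivative q x) (at x)" if "x \<in> - closure D" for x
      using u'[OF helm_out that] q_out[OF that] by simp
    have q'_in: "(q has_vector_derivative - ((of_real (v / v\<^sub>b) * k)\<^sup>2 / \<delta>) * u x) (at x)"
      if "x \<in> D" for x
    proof -
      have "((\<lambda>y. vderiv u y / \<delta>) has_vector_derivative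
          (- (of_real (v / v\<^sub>b) * k)\<^sup>2 * u x) / \<delta>) (at x)"
        by (intro has_vector_derivative_divide u''[OF helm_in that])
      then have "(q has_vector_derivative (- (of_real (v / v\<^sub>b) * k)\<^sup>2 * u x) / \<delta>) (at x)"
        by (rule has_vector_derivative_transform_within_open[OF _ open_D that]) (simp add: q_in)
      then show ?thesis
        by simp
    qed
    have q'_out: "(q has_vector_derivative - k\<^sup>2 * u x) (at x)" if "x \<in> - closure D" for x
      by (rule has_vector_derivative_transform_within_open[OF u''[OF helm_out that] open_exterior that])
        (simp add: q_out)
    have cont_endpoint: "isCont u x \<and> isCont q x" if x: "x \<in> endpoints" for x
    proof -
      have "isCont u x \<and> (\<exists>m. (q0 \<longlongrightarrow> m) (at x))"
      proof -
        consider j where "j \<in> {1..N}" "x = xm j" | j where "j \<in> {1..N}" "x = xp j"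
          using x unfolding endpoints_def by blast
        then show ?thesis
        proof cases
          case 1
          then obtain m where m: "(vderiv u \<longlongrightarrow> \<delta> * m) (at_right x)" "(vderiv u \<longlongrightarrow> m) (at_left x)"
            using trans[of j] by (auto simp: flux_transmission_left_def)
          have "((\<lambda>y. vderiv u y / \<delta>) \<longlongrightarrow> m) (at_right x)"
            using tendsto_divide[OF m(1) tendsto_const[of \<delta>]] \<delta> by simp
          then have "(q0 \<longlongrightarrow> m) (at_right x)"
            by (rule Lim_transform_eventually)
              (use eventually_sides(1)[OF 1(1)] 1(2) in \<open>auto simp: q0_def elim!: eventually_mono\<close>)
          moreover have "(q0 \<longlongrightarrow> m) (at_left x)"
            by (rule Lim_transform_eventually[OF m(2)])
              (use eventually_sides(3)[OF 1(1)] 1(2) closure_subset[of D]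
                in \<open>auto simp: q0_def elim!: eventually_mono\<close>)
          ultimately have "(q0 \<longlongrightarrow> m) (at x)"
            by (simp add: filterlim_at_split)
          moreover have "isCont u x"
            using trans[of j] 1
            by (auto simp: continuous_transmission_def isCont_def filterlim_at_split)
          ultimately show ?thesis
            by blast
        next
          case 2
          then obtain m where m: "(vderiv u \<longlongrightarrow> m) (at_right x)" "(vderiv u \<longlongrightarrow> \<delta> * m) (at_left x)"
            using trans[of j] by (auto simp: flux_transmission_right_def)
          have "((\<lambda>y. vderiv u y / \<delta>) \<longlongrightarrow> m) (at_left x)"
            using tendsto_divide[OF m(2) tendsto_const[of \<delta>]] \<delta> by simp
          then have "(q0 \<longlongrightarrow> m) (at_left x)"
            by (rule Lim_transform_eventually)
              (use eventually_sides(2)[OF 2(1)] 2(2) in \<open>auto simp: q0_def elim!: eventually_mono\<close>)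
          moreover have "(q0 \<longlongrightarrow> m) (at_right x)"
            by (rule Lim_transform_eventually[OF m(1)])
              (use eventually_sides(4)[OF 2(1)] 2(2) closure_subset[of D]
                in \<open>auto simp: q0_def elim!: eventually_mono\<close>)
          ultimately have "(q0 \<longlongrightarrow> m) (at x)"
            by (simp add: filterlim_at_split)
          moreover have "isCont u x"
            using trans[of j] 2
            by (auto simp: continuous_transmission_def isCont_def filterlim_at_split)
          ultimately show ?thesis
            by blast
        qed
      qed
      then obtain m where m: "(q0 \<longlongrightarrow> m) (at x)" and "isCont u x"
        by blast
      have "\<forall>\<^sub>F y in at x. y \<notin> endpoints"
        using finite_endpoints islimpt_finite islimpt_iff_eventually by blast
      then have "(q \<longlongrightarrow> m) (at x)"
        by (intro Lim_transform_eventually[OF m]) (auto simp: q_def elim!: eventually_mono)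
      moreover have "q x = m"
        using that tendsto_Lim[OF _ m] by (simp add: q_def)
      ultimately show ?thesis
        using \<open>isCont u x\<close> by (simp add: isCont_def)
    qed
    have "isCont u x \<and> isCont q x" for x
      using not_endpoint_cases[of x] cont_endpoint[of x]
        u'_in[of x] u'_out[of x] q'_in[of x] q'_out[of x]
      by (blast intro: has_vector_derivative_continuous)
    then have "flux_equations (v / v\<^sub>b) \<delta> k u q"
      unfolding flux_equations_def
      using u'_in u'_out q'_in q'_out by (auto simp: continuous_on_eq_continuous_at)
    moreover have "q x = - \<i> * k * u x" if "x < xm 1" for x
    proof -
      have "q x = vderiv u x"
        using q_out[of x] below_subset_exterior that by auto
      then show ?thesis
        using left[OF that] by (simp add: minus_equation_iff[of "vderiv u x"])
    qed
    moreover have "q x = \<i> * k * u x" if "x > xp N" for x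
      using right[OF that] q_out[of x] above_subset_exterior that by (auto simp: algebra_simps)
    ultimately show "\<exists>q. flux_solution (v / v\<^sub>b) \<delta> (\<omega> / of_real v) u q"
      unfolding flux_solution_def k_def by blast
  next
    assume "\<exists>q. flux_solution (v / v\<^sub>b) \<delta> (\<omega> / of_real v) u q"
    then obtain q where sol: "flux_solution (v / v\<^sub>b) \<delta> k u q"
      by (auto simp: k_def)
    have contu: "isCont u x" and contq: "isCont q x" for x
      using sol by (auto simp: flux_solution_def flux_equations_def continuous_on_eq_continuous_at)
    have u'_in: "(u has_vector_derivative \<delta> * q x) (at x)"
      and q'_in: "(q has_vector_derivative - ((of_real (v / v\<^sub>b) * k)\<^sup>2 / \<delta>) * u x) (at x)"
      if "x \<in> D" for x
      using sol that by (auto simp: flux_solution_def flux_equations_def)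
    have u'_out: "(u has_vector_derivative q x) (at x)"
      and q'_out: "(q has_vector_derivative - k\<^sup>2 * u x) (at x)"
      if "x \<in> - closure D" for x
      using sol that by (auto simp: flux_solution_def flux_equations_def)
    have vd_in: "vderiv u x = \<delta> * q x" if "x \<in> D" for x
      using vector_derivative_at[OF u'_in[OF that]] by (simp add: vderiv_def)
    have vd_out: "vderiv u x = q x" if "x \<in> - closure D" for x
      using vector_derivative_at[OF u'_out[OF that]] by (simp add: vderiv_def)
    have vd'_in: "(vderiv u has_vector_derivative - (of_real (v / v\<^sub>b) * k)\<^sup>2 * u x) (at x)"
      if "x \<in> D" for x
    proof -
      have "((\<lambda>y. \<delta> * q y) has_vector_derivative
          \<delta> * (- ((of_real (v / v\<^sub>b) * k)\<^sup>2 / \<delta>) * u x)) (at x)"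
        by (intro has_vector_derivative_mult_right q'_in that)
      then have "(vderiv u has_vector_derivative
          \<delta> * (- ((of_real (v / v\<^sub>b) * k)\<^sup>2 / \<delta>) * u x)) (at x)"
        by (rule has_vector_derivative_transform_within_open[OF _ open_D that]) (simp add: vd_in)
      then show ?thesis
        using \<delta> by simp
    qed
    have vd'_out: "(vderiv u has_vector_derivative - k\<^sup>2 * u x) (at x)"
      if "x \<in> - closure D" for x
      by (rule has_vector_derivative_transform_within_open[OF q'_out[OF that] open_exterior that])
        (simp add: vd_out)
    have helm: "helmholtz_on S \<kappa> u"
      if "\<And>x. x \<in> S \<Longrightarrow> u differentiable (at x)"
        "\<And>x. x \<in> S \<Longrightarrow> (vderiv u has_vector_derivative - \<kappa>\<^sup>2 * u x) (at x)" for S \<kappa>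
      unfolding helmholtz_on_def
    proof (intro ballI conjI)
      fix x assume x: "x \<in> S"
      show "u differentiable (at x)" "vderiv u differentiable (at x)"
        using that[OF x] by (auto intro: differentiableI_vector)
      show "vderiv (vderiv u) x + \<kappa>\<^sup>2 * u x = 0"
        using vector_derivative_at[OF that(2)[OF x]] by (simp add: vderiv_def[of "vderiv u"])
    qed
    have "helmholtz_on (- closure D) k u"
      by (rule helm) (use u'_out vd'_out in \<open>auto intro: differentiableI_vector\<close>)
    moreover have "helmholtz_on D (of_real (v / v\<^sub>b) * k) u"
      by (rule helm) (use u'_in vd'_in in \<open>auto intro: differentiableI_vector\<close>)
    moreover have "continuous_transmission u x" for x
      using contu[of x] by (auto simp: continuous_transmission_def isCont_def filterlim_at_split)
    moreover have lim: "(q \<longlongrightarrow> q x) (at_left x)" "(q \<longlongrightarrow> q x) (at_right x)"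
      "((\<lambda>y. \<delta> * q y) \<longlongrightarrow> \<delta> * q x) (at_left x)" "((\<lambda>y. \<delta> * q y) \<longlongrightarrow> \<delta> * q x) (at_right x)" for x
      using contq[of x] by (auto simp: isCont_def filterlim_at_split intro!: tendsto_intros)
    have "flux_transmission_left \<delta> u (xm j)" if j: "j \<in> {1..N}" for j
      unfolding flux_transmission_left_def
      by (intro exI[of _ "\<delta> * q (xm j)"] exI[of _ "q (xm j)"] conjI refl
          Lim_transform_eventually[OF lim(4)] Lim_transform_eventually[OF lim(1)])
        (use eventually_sides[OF j] vd_in vd_out in \<open>auto elim!: eventually_mono\<close>)
    moreover have "flux_transmission_right \<delta> u (xp j)" if j: "j \<in> {1..N}" for j
      unfolding flux_transmission_right_def
      by (intro exI[of _ "q (xp j)"] exI[of _ "\<delta> * q (xp j)"] conjI refl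
          Lim_transform_eventually[OF lim(3)] Lim_transform_eventually[OF lim(2)])
        (use eventually_sides[OF j] vd_in vd_out in \<open>auto elim!: eventually_mono\<close>)
    moreover have "- vderiv u x - \<i> * k * u x = 0" if "x < xm 1" for x
      using sol vd_out[of x] below_subset_exterior that by (auto simp: flux_solution_def)
    moreover have "vderiv u x - \<i> * k * u x = 0" if "x > xp N" for x
      using sol vd_out[of x] above_subset_exterior that by (auto simp: flux_solution_def)
    ultimately show "scattering_solution N xm xp v v\<^sub>b \<delta> \<omega> u"
      unfolding scattering_solution_def Let_def kb k_def[symmetric] by blast
  qed
qed

lemma resonant_frequencies_iff_flux_solution:
  assumes "\<delta> \<noteq> 0" "v > 0" "v\<^sub>b > 0"
  shows "\<omega> \<in> resonant_frequencies N xm xp v v\<^sub>b \<delta> \<longleftrightarrow>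
    (\<exists>u q. flux_solution (v / v\<^sub>b) \<delta> (\<omega> / of_real v) u q \<and> (\<exists>x. u x \<noteq> 0))"
  unfolding resonant_frequencies_def resonant_mode_def
    scattering_solution_iff_flux_solution[OF assms] by blast


section \<open>Resonant frequencies\<close>

lemma flux_solution_nonzero_left:
  assumes sol: "flux_solution r \<delta> k u q" and "u y \<noteq> 0"
  obtains x where "x < xm 1" "u x \<noteq> 0"
proof (rule ccontr)
  assume "\<not> thesis"
  then have z: "u x = 0" if "x < xm 1" for x
    using that \<open>\<And>x. x < xm 1 \<Longrightarrow> u x \<noteq> 0 \<Longrightarrow> thesis\<close> by blast
  have "u y = 0 \<and> q y = 0"
    by (rule flux_equations_eq_zero[of r \<delta> k]) (use sol z in \<open>auto simp: flux_solution_def\<close>)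
  then show False
    using assms(2) by simp
qed

lemma resonant_frequency_conjugate:
  assumes "\<delta> \<noteq> 0" "v > 0" "v\<^sub>b > 0" and "\<delta> \<in> \<real>"
    and "\<omega> \<in> resonant_frequencies N xm xp v v\<^sub>b \<delta>"
  shows "- cnj \<omega> \<in> resonant_frequencies N xm xp v v\<^sub>b \<delta>"
proof -
  obtain u q x where sol: "flux_solution (v / v\<^sub>b) \<delta> (\<omega> / of_real v) u q" and "u x \<noteq> 0"
    using assms(5) unfolding resonant_frequencies_iff_flux_solution[OF assms(1-3)] by auto
  have "flux_solution (v / v\<^sub>b) \<delta> (- cnj \<omega> / of_real v) (\<lambda>x. cnj (u x)) (\<lambda>x. cnj (q x))"
    using flux_solution_conjugate[OF sol assms(4)] by simp
  moreover have "cnj (u x) \<noteq> 0"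
    using \<open>u x \<noteq> 0\<close> by simp
  ultimately show ?thesis
    unfolding resonant_frequencies_iff_flux_solution[OF assms(1-3)] by (intro exI conjI)
qed

lemma resonant_frequency_Im_neg:
  assumes "v > 0" "v\<^sub>b > 0" and "\<delta> \<in> \<real>" "Re \<delta> > 0"
    and "\<omega> \<in> resonant_frequencies N xm xp v v\<^sub>b \<delta>" "\<omega> \<noteq> 0"
  shows "Im \<omega> < 0"
proof (rule ccontr)
  assume "\<not> Im \<omega> < 0"
  have "\<delta> \<noteq> 0"
    using assms by auto
  then obtain u q x where sol: "flux_solution (v / v\<^sub>b) \<delta> (\<omega> / of_real v) u q" and "u x \<noteq> 0"
    using assms(5) unfolding resonant_frequencies_iff_flux_solution[OF \<open>\<delta> \<noteq> 0\<close> assms(1,2)] by auto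
  obtain y where "y < xm 1" "u y \<noteq> 0"
    using flux_solution_nonzero_left[OF sol \<open>u x \<noteq> 0\<close>] .
  moreover have "u y = 0"
    by (rule flux_solution_eq_zero_left[OF sol _ assms(4) _ _ \<open>y < xm 1\<close>])
      (use assms \<open>\<not> Im \<omega> < 0\<close> in \<open>auto simp: complex_is_Real_iff complex_eq_iff\<close>)
  ultimately show False
    by simp
qed

text \<open>
  Constants are modes. This is needed for the duality, because the dual of the pair \<open>(1, 0)\<close> at
  \<open>k = 0\<close> vanishes.
\<close>

lemma zero_resonant_frequency:
  assumes "\<delta> \<noteq> 0" "v > 0" "v\<^sub>b > 0"
  shows "0 \<in> resonant_frequencies N xm xp v v\<^sub>b \<delta>"
proof -
  have "flux_solution (v / v\<^sub>b) \<delta> (0 / of_real v) (\<lambda>x. 1) (\<lambda>x. 0)"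
    by (simp add: flux_solution_def flux_equations_def)
  then show ?thesis
    unfolding resonant_frequencies_iff_flux_solution[OF assms]
    by (intro exI[of _ "\<lambda>x. 1"] exI[of _ "\<lambda>x. 0"]) simp
qed

text \<open>
  One inclusion suffices, since \<open>\<delta> \<mapsto> r\<^sup>2 / \<delta>\<close> is an involution.
\<close>

lemma resonant_frequencies_dual_subset:
  assumes "\<delta> \<noteq> 0" "v > 0" "v\<^sub>b > 0"
  shows "resonant_frequencies N xm xp v v\<^sub>b \<delta> \<subseteq>
    resonant_frequencies N xm xp v v\<^sub>b (of_real ((v / v\<^sub>b)\<^sup>2) / \<delta>)"
proof
  fix \<omega> assume \<omega>: "\<omega> \<in> resonant_frequencies N xm xp v v\<^sub>b \<delta>"
  have \<delta>': "of_real ((v / v\<^sub>b)\<^sup>2) / \<delta> \<noteq> 0"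
    using assms by simp
  show "\<omega> \<in> resonant_frequencies N xm xp v v\<^sub>b (of_real ((v / v\<^sub>b)\<^sup>2) / \<delta>)"
  proof (cases "\<omega> = 0")
    case True
    then show ?thesis
      using zero_resonant_frequency[OF \<delta>' assms(2,3)] by simp
  next
    case False
    obtain u q x where sol: "flux_solution (v / v\<^sub>b) \<delta> (\<omega> / of_real v) u q" and "u x \<noteq> 0"
      using \<omega> unfolding resonant_frequencies_iff_flux_solution[OF assms] by auto
    obtain y where y: "y < xm 1" "u y \<noteq> 0"
      using flux_solution_nonzero_left[OF sol \<open>u x \<noteq> 0\<close>] .
    have "\<i> * q y \<noteq> 0"
      using sol y False assms(2) by (simp add: flux_solution_def)
    moreover have "v / v\<^sub>b \<noteq> 0"
      using assms by simp
    note flux_solution_dual[OF sol assms(1) this]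
    ultimately show ?thesis
      unfolding resonant_frequencies_iff_flux_solution[OF \<delta>' assms(2,3)] by (intro exI conjI)
  qed
qed

text \<open>
  The combination of \<open>w\<close> and the dual of \<open>u\<close> used here vanishes on the left by the radiation
  conditions, hence everywhere. For \<open>k = 0\<close> and \<open>t \<noteq> 0\<close> the statement says that \<open>q = 0\<close>, so that
  \<open>u\<close> is constant.
\<close>

lemma flux_solution_dual_unique:
  assumes u: "flux_solution r \<delta> k u q" and w: "flux_solution r (of_real (r\<^sup>2) / \<delta>) k w p"
    and "\<delta> \<noteq> 0" "r \<noteq> 0"
    and left: "\<And>x. x < xm 1 \<Longrightarrow> w x = t * u x"
  shows "k * w x = \<i> * t * q x"
proof -
  let ?z = "\<lambda>x. t * (\<i> * q x) + (- k) * w x"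
  let ?s = "\<lambda>x. t * (- \<i> * k\<^sup>2 * u x) + (- k) * p x"
  have "flux_equations r (of_real (r\<^sup>2) / \<delta>) k ?z ?s"
    using flux_solution_dual[OF u assms(3,4)] w
    by (intro flux_equations_linear_combination) (auto simp: flux_solution_def)
  moreover have "?z y = 0 \<and> ?s y = 0" if "y < xm 1" for y
  proof -
    have "q y = - \<i> * k * u y" "p y = - \<i> * k * w y"
      using u w that by (auto simp: flux_solution_def)
    then show ?thesis
      using left[OF that] by (simp add: power2_eq_square algebra_simps)
  qed
  ultimately have "?z x = 0"
    using flux_equations_eq_zero by blast
  then show ?thesis
    by (simp add: algebra_simps)
qed

lemma flux_solution_within_derivative:
  assumes "flux_solution r \<delta> k u q"
  shows "(u has_vector_derivative \<delta> * q x) (at x within closure D)"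
    "(u has_vector_derivative q x) (at x within - D)"
  using assms
  by (intro has_vector_derivative_within_closure_D has_vector_derivative_within_outside_D;
      auto simp: flux_solution_def flux_equations_def intro!: continuous_intros)+

lemma resonant_mode_derivative:
  assumes "flux_solution r \<delta> k u q" "flux_solution r (of_real (r\<^sup>2) / \<delta>) k w p"
    and "\<delta> \<noteq> 0" "r \<noteq> 0" "t \<noteq> 0"
    and left: "\<And>x. x < xm 1 \<Longrightarrow> w x = t * u x"
  shows "(u has_vector_derivative - \<i> * (\<delta> / (t * of_real r)) * (of_real r * k) * w x)
      (at x within closure D)"
    "(u has_vector_derivative - \<i> * inverse t * k * w x) (at x within - D)"
proof -
  have "\<i> * t * q x = k * w x"
    using flux_solution_dual_unique[OF assms(1-4) left, of x] by simp
  then have q: "q x = - \<i> * inverse t * (k * w x)"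
    using assms(5) by (simp add: field_simps flip: \<open>\<i> * t * q x = k * w x\<close>)
  then have "\<delta> * q x = - \<i> * (\<delta> / (t * of_real r)) * (of_real r * k) * w x"
    using assms(4) by (simp add: field_simps)
  then show "(u has_vector_derivative - \<i> * (\<delta> / (t * of_real r)) * (of_real r * k) * w x)
      (at x within closure D)"
    using flux_solution_within_derivative(1)[OF assms(1), of x] by metis
  have "q x = - \<i> * inverse t * k * w x"
    using q by simp
  then show "(u has_vector_derivative - \<i> * inverse t * k * w x) (at x within - D)"
    using flux_solution_within_derivative(2)[OF assms(1), of x] by metis
qed

end

(* The one-sided derivatives at the endpoints are expressed by taking the derivative within
   closure D (from inside D) and within - D (from outside D). At every other point of these
   sets this is the ordinary derivative. *)
theorem theorem2p2:
  fixes N :: nat and xm xp :: "nat \<Rightarrow> real" and v v\<^sub>b r :: real and \<delta> :: complex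
  assumes "N \<ge> 1"
    and "ordered_endpoints N xm xp"
    and "v > 0" and "v\<^sub>b > 0" and "r = v / v\<^sub>b"
    and "\<delta> \<noteq> 0"
  shows
    "(\<delta> \<in> \<real> \<longrightarrow>
        (\<forall>\<omega>. \<omega> \<in> resonant_frequencies N xm xp v v\<^sub>b \<delta> \<longleftrightarrow>
             - cnj \<omega> \<in> resonant_frequencies N xm xp v v\<^sub>b \<delta>)) \<and>
     (\<delta> \<in> \<real> \<and> Re \<delta> > 0 \<longrightarrow>
        (\<forall>\<omega>\<in>resonant_frequencies N xm xp v v\<^sub>b \<delta>. \<omega> \<noteq> 0 \<longrightarrow> Im \<omega> < 0)) \<and>
     (\<forall>\<delta>\<^sub>0::complex. \<delta>\<^sub>0 \<noteq> 0 \<longrightarrow>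
        resonant_frequencies N xm xp v v\<^sub>b \<delta>\<^sub>0 =
          resonant_frequencies N xm xp v v\<^sub>b (of_real (r\<^sup>2) / \<delta>\<^sub>0) \<and>
        (\<forall>\<omega> u w t.
           resonant_mode N xm xp v v\<^sub>b \<delta>\<^sub>0 \<omega> u \<and>
           resonant_mode N xm xp v v\<^sub>b (of_real (r\<^sup>2) / \<delta>\<^sub>0) \<omega> w \<and>
           t \<noteq> 0 \<and>
           (\<forall>x<xm 1. u x = exp (- \<i> * (\<omega> / of_real v) * of_real x)) \<and>
           (\<forall>x<xm 1. w x = t * exp (- \<i> * (\<omega> / of_real v) * of_real x)) \<longrightarrow>
           (let D = resonators N xm xp; k = \<omega> / of_real v; k\<^sub>b = \<omega> / of_real v\<^sub>b in
             (\<forall>x\<in>closure D.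
                (u has_vector_derivative - \<i> * (\<delta>\<^sub>0 / (t * of_real r)) * k\<^sub>b * w x)
                  (at x within closure D) \<and>
                (w has_vector_derivative - \<i> * (t * of_real r / \<delta>\<^sub>0) * k\<^sub>b * u x)
                  (at x within closure D)) \<and>
             (\<forall>x\<in>- D.
                (u has_vector_derivative - \<i> * inverse t * k * w x) (at x within - D) \<and>
                (w has_vector_derivative - \<i> * t * k * u x) (at x within - D)))))"
proof -
  interpret resonator_chain N xm xp
    using assms(1,2) by unfold_locales
  have r: "r \<noteq> 0"
    using assms(3-5) by simp
  have dual_nonzero: "of_real (r\<^sup>2) / \<delta>\<^sub>0 \<noteq> 0" if "\<delta>\<^sub>0 \<noteq> 0" for \<delta>\<^sub>0 :: complex
    using that r by simp
  \<comment> \<open>The derivative formulas for \<open>w\<close> come from those for \<open>u\<close> with the two modes interchanged, hence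
    with \<open>\<delta>\<^sub>0\<close> and \<open>t\<close> replaced by \<open>r\<^sup>2 / \<delta>\<^sub>0\<close> and \<open>inverse t\<close>.\<close>
  have dual_dual: "of_real (r\<^sup>2) / (of_real (r\<^sup>2) / \<delta>\<^sub>0) = \<delta>\<^sub>0" if "\<delta>\<^sub>0 \<noteq> 0" for \<delta>\<^sub>0 :: complex
    using that r by simp
  have symmetric: "\<omega> \<in> resonant_frequencies N xm xp v v\<^sub>b \<delta> \<longleftrightarrow>
      - cnj \<omega> \<in> resonant_frequencies N xm xp v v\<^sub>b \<delta>" if "\<delta> \<in> \<real>" for \<omega>
    using resonant_frequency_conjugate[OF assms(6,3,4) that, of \<omega>]
      resonant_frequency_conjugate[OF assms(6,3,4) that, of "- cnj \<omega>"] by auto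
  have same: "resonant_frequencies N xm xp v v\<^sub>b \<delta>\<^sub>0 =
      resonant_frequencies N xm xp v v\<^sub>b (of_real (r\<^sup>2) / \<delta>\<^sub>0)" if "\<delta>\<^sub>0 \<noteq> 0" for \<delta>\<^sub>0 :: complex
    using resonant_frequencies_dual_subset[OF that assms(3,4), folded assms(5)]
      resonant_frequencies_dual_subset[OF dual_nonzero[OF that] assms(3,4), folded assms(5)]
    unfolding dual_dual[OF that] by blast
  have modes: "let D = resonators N xm xp; k = \<omega> / of_real v; k\<^sub>b = \<omega> / of_real v\<^sub>b in
      (\<forall>x\<in>closure D.
        (u has_vector_derivative - \<i> * (\<delta>\<^sub>0 / (t * of_real r)) * k\<^sub>b * w x)
          (at x within closure D) \<and>
        (w has_vector_derivative - \<i> * (t * of_real r / \<delta>\<^sub>0) * k\<^sub>b * u x)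
          (at x within closure D)) \<and>
      (\<forall>x\<in>- D.
        (u has_vector_derivative - \<i> * inverse t * k * w x) (at x within - D) \<and>
        (w has_vector_derivative - \<i> * t * k * u x) (at x within - D))"
    if \<delta>\<^sub>0: "\<delta>\<^sub>0 \<noteq> 0"
      and hyps: "resonant_mode N xm xp v v\<^sub>b \<delta>\<^sub>0 \<omega> u \<and>
        resonant_mode N xm xp v v\<^sub>b (of_real (r\<^sup>2) / \<delta>\<^sub>0) \<omega> w \<and> t \<noteq> 0 \<and>
        (\<forall>x<xm 1. u x = exp (- \<i> * (\<omega> / of_real v) * of_real x)) \<and>
        (\<forall>x<xm 1. w x = t * exp (- \<i> * (\<omega> / of_real v) * of_real x))"
    for \<delta>\<^sub>0 \<omega> t :: complex and u w
  proof -
    define k where "k = \<omega> / of_real v"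
    have kb: "\<omega> / of_real v\<^sub>b = of_real r * k"
      using assms(3,5) by (simp add: k_def)
    obtain q where u: "flux_solution r \<delta>\<^sub>0 k u q"
      using hyps scattering_solution_iff_flux_solution[OF \<delta>\<^sub>0 assms(3,4)]
      by (auto simp: resonant_mode_def k_def assms(5))
    obtain p where w: "flux_solution r (of_real (r\<^sup>2) / \<delta>\<^sub>0) k w p"
      using hyps scattering_solution_iff_flux_solution[OF dual_nonzero[OF \<delta>\<^sub>0] assms(3,4)]
      by (auto simp: resonant_mode_def k_def assms(5))
    have u': "flux_solution r (of_real (r\<^sup>2) / (of_real (r\<^sup>2) / \<delta>\<^sub>0)) k u q"
      using u by (simp only: dual_dual[OF \<delta>\<^sub>0])
    have t: "t \<noteq> 0"
      using hyps by simp
    have wu: "w x = t * u x" and uw: "u x = inverse t * w x" if "x < xm 1" for x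
      using hyps that t by auto
    have t': "inverse t \<noteq> 0"
      using t by simp
    have coeff: "of_real (r\<^sup>2) / \<delta>\<^sub>0 / (inverse t * of_real r) = t * of_real r / \<delta>\<^sub>0"
      using r t by (simp add: power2_eq_square field_simps)
    show ?thesis
      unfolding Let_def kb k_def[symmetric]
      using resonant_mode_derivative[OF u w \<delta>\<^sub>0 r t wu]
        resonant_mode_derivative[OF w u' dual_nonzero[OF \<delta>\<^sub>0] r t' uw, unfolded coeff inverse_inverse_eq]
      by blast
  qed
  show ?thesis
  proof (intro conjI allI impI)
    fix \<omega> assume "\<delta> \<in> \<real>"
    then show "\<omega> \<in> resonant_frequencies N xm xp v v\<^sub>b \<delta> \<longleftrightarrow>
        - cnj \<omega> \<in> resonant_frequencies N xm xp v v\<^sub>b \<delta>"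
      by (rule symmetric)
  next
    assume "\<delta> \<in> \<real> \<and> Re \<delta> > 0"
    then show "\<forall>\<omega>\<in>resonant_frequencies N xm xp v v\<^sub>b \<delta>. \<omega> \<noteq> 0 \<longrightarrow> Im \<omega> < 0"
      using resonant_frequency_Im_neg[OF assms(3,4)] by blast
  qed (rule same modes; assumption)+
qed

end
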